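(* Let $\lambda,\delta$ be real numbers with $0\le\delta\le\lambda\le 1$, let $\varphi,\psi\in\mathcal N$, and let $f(z)=z+\sum_{n=2}^{\infty}a_nz^n$ belong to the class $\mathcal S_{\lambda,\delta}(\varphi,\psi)$. Then for every integer $n\ge 2$, $$\left[1+(n-1)(\lambda-\delta+2\lambda\delta)+(n-1)(n-2)\lambda\delta\right]|a_n|\le \frac{\prod_{j=0}^{n-2}\left(j+|\psi'(0)|\right)}{(n-1)!}+|\varphi'(0)|\left(1+\sum_{k=1}^{n-2}\frac{\prod_{j=0}^{n-k-2}\left(j+|\psi'(0)|\right)}{(n-k-1)!}\right).$$ (The sum over $k$ is empty, i.e. equal to $0$, when $n=2$.)
   Context: $\mathbb D=\{z\in\mathbb C:|z|<1\}$. $\mathcal A$ is the family of functions analytic in $\mathbb D$ of the form $f(z)=z+\sum_{n\ge2}a_nz^n$. For analytic $F,G$ on $\mathbb D$ with $F(0)=G(0)$, $F$ is subordinate to $G$, written $F\prec G$, if there is an analytic function $h$ on $\mathbb D$ with $h(0)=0$, $|h(z)|<1$ and $F(z)=G(h(z))$ for all $z\in\mathbb D$. Quotients with a removable singularity at $z=0$ are extended there by their limit. $\mathcal N$ is the class of analytic univalent functions $\varphi:\mathbb D\to\mathbb C$ such that $\varphi(\mathbb D)$ is convex, $\varphi(0)=1$ and $\Re\varphi(z)>0$ for $z\in\mathbb D$. For $\psi\in\mathcal N$, $\mathcal S^*(\psi)$ is the class of $g\in\mathcal A$ such that $\frac{zg'(z)}{g(z)}\prec\psi(z)$ in $\mathbb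 D$. For $0\le\delta\le\lambda\le1$ and $\varphi,\psi\in\mathcal N$, $\mathcal S_{\lambda,\delta}(\varphi,\psi)$ is the class of $f\in\mathcal A$ for which there exists $g\in\mathcal S^*(\psi)$ with $$\frac{(1-\lambda+\delta)f(z)+(\lambda-\delta)zf'(z)+\lambda\delta z^2f''(z)}{g(z)}\prec\varphi(z)\qquad(z\in\mathbb D).$$ *)

theory Defs
  imports "HOL-Complex_Analysis.Complex_Analysis"
begin

abbreviation unit_disc :: "complex set" where
  "unit_disc \<equiv> ball 0 1"

(* Isabelle sets 0 / 0 = 0, so a quotient with a removable singularity at the origin has to be
   given its limit there explicitly.  No other point is changed. *)
definition extend_at_0 :: "(complex \<Rightarrow> complex) \<Rightarrow> complex \<Rightarrow> complex" where
  "extend_at_0 q z = (if z = 0 then Lim (at 0) q else q z)"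

definition subordinate :: "(complex \<Rightarrow> complex) \<Rightarrow> (complex \<Rightarrow> complex) \<Rightarrow> bool" where
  "subordinate F G \<longleftrightarrow>
     F holomorphic_on unit_disc \<and> G holomorphic_on unit_disc \<and> F 0 = G 0 \<and>
     (\<exists>h. h holomorphic_on unit_disc \<and> h 0 = 0 \<and> (\<forall>z\<in>unit_disc. norm (h z) < 1) \<and>
          (\<forall>z\<in>unit_disc. F z = G (h z)))"

(* f z = z + (\<Sum>n\<ge>2. a n * z ^ n) on the disc; the values a 0 and a 1 are irrelevant. *)
definition normalized_expansion :: "(complex \<Rightarrow> complex) \<Rightarrow> (nat \<Rightarrow> complex) \<Rightarrow> bool" where
  "normalized_expansion f a \<longleftrightarrow>
     (\<forall>z\<in>unit_disc. (\<lambda>n. a (n + 2) * z ^ (n + 2)) sums (f z - z))"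

definition class_A :: "(complex \<Rightarrow> complex) set" where
  "class_A = {f. f holomorphic_on unit_disc \<and> (\<exists>a. normalized_expansion f a)}"

definition class_N :: "(complex \<Rightarrow> complex) set" where
  "class_N = {\<phi>. \<phi> holomorphic_on unit_disc \<and> inj_on \<phi> unit_disc \<and>
                  convex (\<phi> ` unit_disc) \<and> \<phi> 0 = 1 \<and> (\<forall>z\<in>unit_disc. Re (\<phi> z) > 0)}"

definition class_S_star :: "(complex \<Rightarrow> complex) \<Rightarrow> (complex \<Rightarrow> complex) set" where
  "class_S_star \<psi> =
     {g \<in> class_A. subordinate (extend_at_0 (\<lambda>z. z * deriv g z / g z)) \<psi>}"

definition class_S ::
  "real \<Rightarrow> real \<Rightarrow> (complex \<Rightarrow> complex) \<Rightarrow> (complex \<Rightarrow> complex) \<Rightarrow> (complex \<Rightarrow> complex) set" where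
  "class_S lam del \<phi> \<psi> =
     {f \<in> class_A. \<exists>g \<in> class_S_star \<psi>.
        subordinate
          (extend_at_0 (\<lambda>z. (of_real (1 - lam + del) * f z
                             + of_real (lam - del) * z * deriv f z
                             + of_real (lam * del) * z\<^sup>2 * deriv (deriv f) z) / g z))
          \<phi>}"

end

theory Submission
  imports Defs
begin

text \<open>
  For \<open>p \<prec> \<phi>\<close>, averaging \<open>p\<close> over the \<open>n\<close>-th roots of unity gives a function of \<open>z ^ n\<close> that still takes its
  values in the convex set \<open>\<phi>(D)\<close>; pulling it back by \<open>\<phi>\<close> and applying Schwarz's lemma gives
  Rogosinski's bound \<open>\<bar>p\<^sub>n\<bar> \<le> \<bar>\<phi>'(0)\<bar>\<close>.  Comparing coefficients in \<open>z g' = q g\<close> with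
  \<open>q \<prec> \<psi>\<close> bounds the coefficients of \<open>g\<close> recursively, and comparing them in \<open>F = p g\<close>, where \<open>F\<close>
  is the numerator in the definition of the class and \<open>p \<prec> \<phi>\<close>, bounds those of \<open>f\<close>.
\<close>

section \<open>Rogosinski's coefficient bound for convex images\<close>

text \<open>This filter singles out the exponents divisible by \<open>n\<close>: the sum is
  geometric with ratio \<open>\<omega> ^ k\<close>, an \<open>n\<close>-th root of unity that equals
  1 exactly when \<open>n dvd k\<close>.\<close>

lemma sum_roots_unity_power:
  fixes n k :: nat
  assumes "n \<ge> 1"
  shows "(\<Sum>j<n. (exp (2 * of_real pi * \<i> / of_nat n) ^ j) ^ k) =
           (if n dvd k then of_nat n else 0 :: complex)"
proof -
  define \<omega> :: complex where "\<omega> = exp (2 * of_real pi * \<i> / of_nat n)"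
  have \<omega>k: "\<omega> ^ k = exp (2 * of_real pi * \<i> * of_nat k / of_nat n)" for k
    unfolding \<omega>_def by (simp add: exp_of_nat_mult [symmetric] mult_ac)
  have eq1: "\<omega> ^ k = 1 \<longleftrightarrow> n dvd k" for k
    unfolding \<omega>k using assms by (rule complex_root_unity_eq_1)
  have swap: "(\<omega> ^ j) ^ k = (\<omega> ^ k) ^ j" for j
    by (simp add: power_mult [symmetric] mult.commute)
  have "(\<Sum>j<n. (\<omega> ^ k) ^ j) = (if n dvd k then of_nat n else 0)"
  proof (cases "n dvd k")
    case False
    have "(\<omega> ^ k) ^ n = 1"
      by (metis eq1 dvd_triv_right power_mult)
    then show ?thesis
      using False eq1 by (simp add: sum_gp_strict)
  qed (simp add: iffD2 [OF eq1])
  then show ?thesis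
    unfolding \<omega>_def [symmetric] swap .
qed

text \<open>Composing \<open>Q\<close> with the inverse of \<open>\<phi>\<close> gives a Schwarz
  function \<open>h\<close> with \<open>\<phi> \<circ> h = Q\<close> on the disc; the chain rule at
  0 and Schwarz's bound on \<open>deriv h 0\<close> do the rest.\<close>

lemma subset_univalent_image_deriv_le:
  fixes Q \<phi> :: "complex \<Rightarrow> complex"
  assumes Q: "Q holomorphic_on unit_disc" "Q ` unit_disc \<subseteq> \<phi> ` unit_disc" "Q 0 = \<phi> 0"
    and \<phi>: "\<phi> holomorphic_on unit_disc" "inj_on \<phi> unit_disc"
  shows "norm (deriv Q 0) \<le> norm (deriv \<phi> 0)"
proof -
  obtain k where k: "k holomorphic_on \<phi> ` unit_disc" "\<And>z. z \<in> unit_disc \<Longrightarrow> k (\<phi> z) = z"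
    using holomorphic_has_inverse [OF \<phi>(1) open_ball \<phi>(2)] by metis
  define h where "h = k \<circ> Q"
  have h_hol: "h holomorphic_on unit_disc"
    unfolding h_def using Q k(1) by (intro holomorphic_on_compose_gen)
  have h_disc: "norm (h z) < 1 \<and> \<phi> (h z) = Q z" if z: "norm z < 1" for z
  proof -
    obtain w where "w \<in> unit_disc" "Q z = \<phi> w"
      using Q(2) z by force
    then show ?thesis
      using k(2) by (simp add: h_def)
  qed
  have h0: "h 0 = 0"
    using k(2) by (simp add: h_def Q(3))
  have "norm (deriv h 0) \<le> 1"
    using h_disc by (intro Schwarz_Lemma(2) [OF h_hol h0, of 0]) auto
  moreover have "deriv Q 0 = deriv \<phi> 0 * deriv h 0"
  proof -
    have "(\<phi> \<circ> h has_field_derivative deriv \<phi> (h 0) * deriv h 0) (at 0)"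
      by (intro DERIV_chain holomorphic_derivI [of _ unit_disc] h_hol)
         (auto simp: h0 intro: \<phi>(1) h_hol)
    then have "(Q has_field_derivative deriv \<phi> (h 0) * deriv h 0) (at 0)"
      by (rule has_field_derivative_transform_within_open [OF _ open_ball [of 0 1]])
         (use h_disc in auto)
    then show ?thesis
      by (simp add: h0 DERIV_imp_deriv)
  qed
  ultimately show ?thesis
    by (simp add: norm_mult mult_left_le)
qed

text \<open>Averaging over rotations keeps only the coefficients of index \<open>n * k\<close>. Read
  as a series in \<open>z ^ n\<close>, the average has \<open>fps_nth P n\<close> as its linear
  coefficient, so the bound on derivatives at 0 applies.\<close>

lemma Rogosinski_convex:
  fixes p \<phi> :: "complex \<Rightarrow> complex"
  assumes p: "p holomorphic_on unit_disc" "p ` unit_disc \<subseteq> \<phi> ` unit_disc" "p 0 = \<phi> 0"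
    and \<phi>: "\<phi> holomorphic_on unit_disc" "inj_on \<phi> unit_disc" "convex (\<phi> ` unit_disc)"
    and P: "p has_fps_expansion P" and n: "n \<ge> 1"
  shows "norm (fps_nth P n) \<le> norm (deriv \<phi> 0)"
proof -
  define \<omega> :: complex where "\<omega> = exp (2 * of_real pi * \<i> / of_nat n)"
  have norm_\<omega>: "norm \<omega> = 1"
    by (simp add: \<omega>_def)
  have p_sums: "(\<lambda>k. fps_nth P k * z ^ k) sums p z" if "norm z < 1" for z
    using has_fps_expansion_imp_sums_complex [OF P, of 1 z] p(1) that by (simp add: one_ereal_def)
  \<comment> \<open>Defining \<open>Q\<close> by its series avoids choosing a branch of the
    \<open>n\<close>-th root; that \<open>Q u\<close> is an average of values of \<open>p\<close> is
    then checked pointwise, with any root \<open>z\<close> of \<open>u\<close>.\<close>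
  define Q where "Q u = (\<Sum>k. fps_nth P (n * k) * u ^ k)" for u
  have *: "(\<lambda>k. fps_nth P (n * k) * u ^ k) sums Q u \<and> Q u \<in> \<phi> ` unit_disc"
    if u: "norm u < 1" for u
  proof -
    obtain z where z: "u = z ^ n"
      using exists_complex_root n by (metis not_one_le_zero)
    have z1: "norm z < 1"
      using u n unfolding z norm_power by (metis linorder_not_le one_le_power)
    define s where "s = (\<Sum>j<n. (1 / real n) *\<^sub>R p (\<omega> ^ j * z))"
    have norm_jz: "norm (\<omega> ^ j * z) < 1" for j
      using z1 by (simp add: norm_mult norm_power norm_\<omega>)
    have "s \<in> \<phi> ` unit_disc"
      unfolding s_def using n norm_jz p(2)
      by (intro convex_sum \<phi>) (auto simp: image_subset_iff)
    moreover have "(\<lambda>k. \<Sum>j<n. (1 / real n) *\<^sub>R (fps_nth P k * (\<omega> ^ j * z) ^ k)) sums s"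
      unfolding s_def by (intro sums_sum sums_scaleR_right p_sums norm_jz)
    moreover have "(\<Sum>j<n. (1 / real n) *\<^sub>R (fps_nth P k * (\<omega> ^ j * z) ^ k)) =
                     (if n dvd k then fps_nth P k * z ^ k else 0)" for k
    proof -
      have "(\<Sum>j<n. (1 / real n) *\<^sub>R (fps_nth P k * (\<omega> ^ j * z) ^ k)) =
              (fps_nth P k * z ^ k / of_nat n) * (\<Sum>j<n. (\<omega> ^ j) ^ k)"
        unfolding sum_distrib_left
        by (intro sum.cong refl) (simp add: scaleR_conv_of_real power_mult_distrib)
      then show ?thesis
        unfolding \<omega>_def sum_roots_unity_power [OF n] using n by simp
    qed
    ultimately have "(\<lambda>k. if n dvd k then fps_nth P k * z ^ k else 0) sums s"
      by simp
    moreover have "strict_mono (\<lambda>k. n * k)"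
      using n by (simp add: strict_mono_def)
    \<comment> \<open>All terms outside the range of \<open>\<lambda>k. n * k\<close> vanish, so
      reindexing along this map keeps the sum.\<close>
    ultimately have "(\<lambda>k. if n dvd n * k then fps_nth P (n * k) * z ^ (n * k) else 0) sums s"
      by (subst sums_mono_reindex [of "\<lambda>k. n * k"]) auto
    then have "(\<lambda>k. fps_nth P (n * k) * u ^ k) sums s"
      by (simp add: z power_mult)
    moreover from this have "Q u = s"
      unfolding Q_def by (rule sums_unique [symmetric])
    ultimately show ?thesis
      using \<open>s \<in> \<phi> ` unit_disc\<close> by simp
  qed
  have Q_hol: "Q holomorphic_on unit_disc"
    by (rule power_series_holomorphic [of _ _ "\<lambda>k. fps_nth P (n * k)"]) (use * in simp)
  have "\<forall>\<^sub>F u in nhds 0. u \<in> unit_disc"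
    by (intro eventually_nhds_in_open) auto
  then have Q_exp: "Q has_fps_expansion Abs_fps (\<lambda>k. fps_nth P (n * k))"
    by (intro has_fps_expansionI) (auto elim!: eventually_mono simp: *)
  have "Q 0 = \<phi> 0"
    using has_fps_expansion_imp_0_eq_fps_nth_0 [OF Q_exp]
      has_fps_expansion_imp_0_eq_fps_nth_0 [OF P] p(3) by simp
  then have "norm (deriv Q 0) \<le> norm (deriv \<phi> 0)"
    using * by (intro subset_univalent_image_deriv_le Q_hol \<phi>) auto
  then show ?thesis
    using fps_nth_fps_expansion [OF Q_exp, of 1] by simp
qed

section \<open>From subordination to power series\<close>

text \<open>Rogosinski's bound in the form needed for both \<open>\<psi>\<close> and
  \<open>\<phi>\<close>. The Schwarz function of the subordination serves only to give the inclusion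
  of the images.\<close>

lemma subordinate_coeff_le:
  assumes sub: "subordinate p \<phi>" and \<phi>: "\<phi> \<in> class_N"
  obtains P where "p has_fps_expansion P" "fps_nth P 0 = 1"
    "\<And>n. n \<ge> 1 \<Longrightarrow> norm (fps_nth P n) \<le> norm (deriv \<phi> 0)"
proof -
  have p: "p holomorphic_on unit_disc" "p ` unit_disc \<subseteq> \<phi> ` unit_disc" "p 0 = \<phi> 0"
    using sub by (auto simp: subordinate_def)
  have P: "p has_fps_expansion fps_expansion p 0"
    by (rule has_fps_expansion_fps_expansion [OF open_ball _ p(1)]) simp
  show ?thesis
  proof (rule that [OF P])
    show "fps_nth (fps_expansion p 0) 0 = 1"
      using has_fps_expansion_imp_0_eq_fps_nth_0 [OF P] p(3) \<phi> by (simp add: class_N_def)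
    show "norm (fps_nth (fps_expansion p 0) n) \<le> norm (deriv \<phi> 0)" if "n \<ge> 1" for n
      using \<phi> that by (intro Rogosinski_convex [OF p _ _ _ P]) (auto simp: class_N_def)
  qed
qed

text \<open>
  The denominator has no zeros off the origin: at such a zero the junk value \<open>x / 0 = 0\<close> of the
  quotient would contradict that \<open>\<phi>\<close> has positive real part.
\<close>
lemma subordinate_quotient_mult:
  assumes sub: "subordinate (extend_at_0 (\<lambda>z. F z / g z)) \<phi>" and \<phi>: "\<phi> \<in> class_N"
    and "F 0 = 0" "g 0 = 0" and z: "z \<in> unit_disc"
  shows "F z = extend_at_0 (\<lambda>z. F z / g z) z * g z"
proof (cases "z = 0")
  case False
  obtain h where "norm (h z) < 1" "extend_at_0 (\<lambda>z. F z / g z) z = \<phi> (h z)"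
    using sub z unfolding subordinate_def by blast
  then have "Re (F z / g z) > 0"
    using \<phi> False by (simp add: class_N_def extend_at_0_def)
  then have "g z \<noteq> 0"
    by auto
  then show ?thesis
    using False by (simp add: extend_at_0_def)
qed (use assms in simp)

text \<open>\<open>normalized_expansion\<close> says nothing about \<open>a 0\<close> and
  \<open>a 1\<close>, so these are overwritten by the true coefficients 0 and 1.\<close>

lemma normalized_expansion_has_fps_expansion:
  assumes "normalized_expansion f a"
  shows "f has_fps_expansion Abs_fps (\<lambda>n. if n = 0 then 0 else if n = 1 then 1 else a n)"
proof (rule has_fps_expansionI)
  have "\<forall>\<^sub>F z in nhds 0. z \<in> unit_disc"
    by (intro eventually_nhds_in_open) auto
  then show "\<forall>\<^sub>F z in nhds 0. (\<lambda>n. fps_nth (Abs_fps (\<lambda>n. if n = 0 then 0 else if n = 1 then 1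
      else a n)) n * z ^ n) sums f z"
  proof eventually_elim
    case (elim z)
    let ?t = "\<lambda>n. (if n = 0 then 0 else if n = 1 then 1 else a n) * z ^ n"
    have "(\<lambda>n. ?t (n + 2)) sums (f z - (\<Sum>n<2. ?t n))"
      using assms elim by (simp add: normalized_expansion_def numeral_2_eq_2)
    then have "?t sums f z"
      by (rule sums_iff_shift' [THEN iffD1])
    then show ?case
      by simp
  qed
qed

section \<open>Coefficients of functions in the starlike class\<close>

text \<open>This closes the recursion for the starlike coefficients. In the induction step the new
  summand raises the factor \<open>m\<close> to \<open>B + m\<close>, the next factor of the
  Pochhammer symbol.\<close>

lemma pochhammer_div_fact_sum:
  fixes B :: "'a :: field_char_0"
  shows "B * (\<Sum>i<m. pochhammer B i / fact i) = of_nat m * (pochhammer B m / fact m)"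
proof (induction m)
  case (Suc m)
  then show ?case
    by (simp add: distrib_left pochhammer_Suc field_simps del: of_nat_Suc)
qed simp

text \<open>The bounds are the Taylor coefficients of z/(1-z)^B with B =
  \<open>norm (deriv \<psi> 0)\<close>. They solve with equality the recursion obtained from
  \<open>z * deriv g z = q z * g z\<close> when every coefficient of \<open>q\<close> past the
  constant one is replaced by B.\<close>

lemma class_S_star_coeff_le:
  assumes g: "g \<in> class_S_star \<psi>" and \<psi>: "\<psi> \<in> class_N"
  obtains G where "g has_fps_expansion G" "fps_nth G 0 = 0" "fps_nth G 1 = 1"
    "\<And>m. norm (fps_nth G (Suc m)) \<le> pochhammer (norm (deriv \<psi> 0)) m / fact m"
proof -
  obtain b where "normalized_expansion g b"
    using g by (auto simp: class_S_star_def class_A_def)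
  note exp_g = normalized_expansion_has_fps_expansion [OF this]
  define G where "G = Abs_fps (\<lambda>n. if n = 0 then 0 else if n = 1 then 1 else b n)"
  have G: "g has_fps_expansion G" "fps_nth G 0 = 0" "fps_nth G 1 = 1"
    using exp_g by (simp_all add: G_def)
  define q where "q = extend_at_0 (\<lambda>z. z * deriv g z / g z)"
  have sub: "subordinate q \<psi>"
    using g by (simp add: class_S_star_def q_def)
  from subordinate_coeff_le [OF this \<psi>]
  obtain P where P: "q has_fps_expansion P" "fps_nth P 0 = 1"
    "\<And>n. n \<ge> 1 \<Longrightarrow> norm (fps_nth P n) \<le> norm (deriv \<psi> 0)" by blast
  have "g 0 = 0"
    using has_fps_expansion_imp_0_eq_fps_nth_0 [OF G(1)] G(2) by simp
  then have eq: "z * deriv g z = q z * g z" if "z \<in> unit_disc" for z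
    unfolding q_def using sub \<psi> that
    by (intro subordinate_quotient_mult) (simp_all add: q_def)
  have "\<forall>\<^sub>F z in nhds 0. z \<in> unit_disc"
    by (intro eventually_nhds_in_open) auto
  then have "\<forall>\<^sub>F z in nhds 0. z * deriv g z = q z * g z"
    by eventually_elim (rule eq)
  moreover have "(\<lambda>z. z * deriv g z) has_fps_expansion fps_X * fps_deriv G"
    by (intro fps_expansion_intros G)
  ultimately have "(\<lambda>z. q z * g z) has_fps_expansion fps_X * fps_deriv G"
    using has_fps_expansion_cong [of "\<lambda>z. z * deriv g z"] by metis
  then have fps_eq: "fps_X * fps_deriv G = P * G"
    using fps_expansion_unique_complex has_fps_expansion_mult [OF P(1) G(1)] by blast
  define B where "B = norm (deriv \<psi> 0)"
  have bound: "norm (fps_nth G (Suc m)) \<le> pochhammer B m / fact m" for m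
  proof (induction m rule: less_induct)
    case (less m)
    show ?case
    \<comment> \<open>At \<open>m = 0\<close> the recursion reads 0 = 0; the start comes from the
      normalization of \<open>g\<close> instead.\<close>
    proof (cases "m = 0")
      case False
      have "of_nat (Suc m) * fps_nth G (Suc m) = (\<Sum>i=0..Suc m. fps_nth P i * fps_nth G (Suc m - i))"
        unfolding fps_mult_nth [symmetric] fps_eq [symmetric] by simp
      \<comment> \<open>Since \<open>fps_nth P 0 = 1\<close>, the first summand is the unknown
        itself; moving it to the left lowers the factor \<open>Suc m\<close> to
        \<open>m\<close>.\<close>
      also have "\<dots> = fps_nth G (Suc m) + (\<Sum>i\<le>m. fps_nth P (Suc i) * fps_nth G (m - i))"
        unfolding atLeast0AtMost sum.atMost_Suc_shift by (simp add: P(2))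
      also have "(\<Sum>i\<le>m. fps_nth P (Suc i) * fps_nth G (m - i)) =
                   (\<Sum>i<m. fps_nth P (Suc i) * fps_nth G (m - i))"
        by (simp add: lessThan_Suc_atMost [symmetric] G(2))
      \<comment> \<open>Reversing the sum puts the coefficients of \<open>G\<close> in the form
        \<open>Suc i\<close> with \<open>i < m\<close> required by the induction hypothesis.\<close>
      also have "\<dots> = (\<Sum>i<m. fps_nth P (m - i) * fps_nth G (Suc i))"
        by (subst sum.nat_diff_reindex [symmetric]) (simp add: Suc_diff_Suc)
      finally have "of_nat m * fps_nth G (Suc m) = (\<Sum>i<m. fps_nth P (m - i) * fps_nth G (Suc i))"
        by (simp add: algebra_simps)
      then have "real m * norm (fps_nth G (Suc m)) =
                   norm (\<Sum>i<m. fps_nth P (m - i) * fps_nth G (Suc i))"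
        by (metis norm_mult norm_of_nat)
      also have "\<dots> \<le> (\<Sum>i<m. B * (pochhammer B i / fact i))"
        using P(3) less
        by (intro sum_norm_le) (auto simp: B_def norm_mult simp del: times_divide_eq_right
            intro!: mult_mono)
      also have "\<dots> = real m * (pochhammer B m / fact m)"
        unfolding sum_distrib_left [symmetric] by (rule pochhammer_div_fact_sum)
      finally show ?thesis
        using False by (simp del: times_divide_eq_right)
    qed (use G in simp)
  qed
  then show ?thesis
    using that [OF G] by (simp add: B_def)
qed

section \<open>Coefficients of the class defined by the quotient\<close>

theorem theorem4:
  fixes lam del :: real
    and \<phi> \<psi> f :: "complex \<Rightarrow> complex"
    and a :: "nat \<Rightarrow> complex"
    and n :: nat
  assumes "0 \<le> del" and "del \<le> lam" and "lam \<le> 1"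
    and "\<phi> \<in> class_N" and "\<psi> \<in> class_N"
    and "f \<in> class_S lam del \<phi> \<psi>"
    and "normalized_expansion f a"
    and "n \<ge> 2"
  shows "(1 + (real n - 1) * (lam - del + 2 * lam * del)
            + (real n - 1) * (real n - 2) * lam * del) * norm (a n)
         \<le> (\<Prod>j=0..n-2. real j + norm (deriv \<psi> 0)) / fact (n - 1)
           + norm (deriv \<phi> 0) *
             (1 + (\<Sum>k=1..n-2. (\<Prod>j=0..n-k-2. real j + norm (deriv \<psi> 0)) / fact (n - k - 1)))"
proof -
  define N where "N = (\<lambda>z. of_real (1 - lam + del) * f z + of_real (lam - del) * z * deriv f z
                             + of_real (lam * del) * z\<^sup>2 * deriv (deriv f) z)"
  obtain g where g: "g \<in> class_S_star \<psi>" "subordinate (extend_at_0 (\<lambda>z. N z / g z)) \<phi>"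
    using assms by (auto simp: class_S_def N_def)
  define p where "p = extend_at_0 (\<lambda>z. N z / g z)"
  have sub: "subordinate p \<phi>"
    using g(2) by (simp add: p_def)
  from class_S_star_coeff_le [OF g(1) \<open>\<psi> \<in> class_N\<close>]
  obtain G where G: "g has_fps_expansion G" "fps_nth G 0 = 0" "fps_nth G 1 = 1"
    "\<And>m. norm (fps_nth G (Suc m)) \<le> pochhammer (norm (deriv \<psi> 0)) m / fact m" by blast
  from subordinate_coeff_le [OF sub \<open>\<phi> \<in> class_N\<close>]
  obtain P where P: "p has_fps_expansion P" "fps_nth P 0 = 1"
    "\<And>n. n \<ge> 1 \<Longrightarrow> norm (fps_nth P n) \<le> norm (deriv \<phi> 0)" by blast
  define A where "A = Abs_fps (\<lambda>n. if n = 0 then 0 else if n = 1 then 1 else a n)"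
  have A: "f has_fps_expansion A"
    unfolding A_def by (rule normalized_expansion_has_fps_expansion) fact
  define M where "M = fps_const (of_real (1 - lam + del)) * A
    + fps_const (of_real (lam - del)) * fps_X * fps_deriv A
    + fps_const (of_real (lam * del)) * fps_X\<^sup>2 * fps_deriv (fps_deriv A)"
  have N: "N has_fps_expansion M"
    unfolding N_def M_def by (intro fps_expansion_intros A)
  have "f 0 = 0" "g 0 = 0"
    using has_fps_expansion_imp_0_eq_fps_nth_0 [OF G(1)] G(2)
      has_fps_expansion_imp_0_eq_fps_nth_0 [OF A] by (simp_all add: A_def)
  then have eq: "N z = p z * g z" if "z \<in> unit_disc" for z
    unfolding p_def using sub \<open>\<phi> \<in> class_N\<close> that
    by (intro subordinate_quotient_mult) (simp_all add: p_def N_def)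
  have "\<forall>\<^sub>F z in nhds 0. z \<in> unit_disc"
    by (intro eventually_nhds_in_open) auto
  then have "\<forall>\<^sub>F z in nhds 0. N z = p z * g z"
    by eventually_elim (rule eq)
  then have "(\<lambda>z. p z * g z) has_fps_expansion M"
    using N has_fps_expansion_cong [of N] by metis
  then have fps_eq: "M = P * G"
    using fps_expansion_unique_complex has_fps_expansion_mult [OF P(1) G(1)] by blast

  obtain m where n: "n = m + 2"
    using \<open>n \<ge> 2\<close> le_Suc_ex by (metis add.commute)
  define c where "c = 1 + (real n - 1) * (lam - del + 2 * lam * del)
            + (real n - 1) * (real n - 2) * lam * del"
  \<comment> \<open>The ordering of \<open>lam\<close> and \<open>del\<close> is used here, so that
    later \<open>norm (of_real c)\<close> is \<open>c\<close> itself.\<close>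
  have c_nonneg: "c \<ge> 0"
    using assms(1,2) unfolding c_def n by (intro add_nonneg_nonneg mult_nonneg_nonneg) auto
  define B where "B = norm (deriv \<psi> 0)"
  define C where "C = norm (deriv \<phi> 0)"
  \<comment> \<open>The three terms of the numerator multiply \<open>a n\<close> by 1 +
    (n-1)(lam-del) + n(n-1) lam del; writing the factor n as 2 + (n-2) gives the form of
    \<open>c\<close>.\<close>
  have "of_real c * a n = fps_nth M n"
    unfolding M_def n c_def A_def
    by (simp add: fps_X_power_mult_nth mult.assoc algebra_simps)
  also have "\<dots> = (\<Sum>i\<le>m + 2. fps_nth P i * fps_nth G (m + 2 - i))"
    by (simp add: fps_eq fps_mult_nth n atLeast0AtMost)
  also have "\<dots> = fps_nth G (m + 2) + (\<Sum>i=1..m. fps_nth P i * fps_nth G (m + 2 - i))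
                    + fps_nth P (m + 1)"
  proof -
    \<comment> \<open>The extreme indices are special: \<open>i = 0\<close> leaves
      \<open>fps_nth G (m + 2)\<close> because P starts with 1, \<open>i = m + 1\<close> leaves
      \<open>fps_nth P (m + 1)\<close> because G has linear coefficient 1, and
      \<open>i = m + 2\<close> vanishes. The second of these yields the isolated 1 in the bracket of
      the claim.\<close>
    have "{..m + 2} = {0, m + 1, m + 2} \<union> {1..m}"
      by auto
    then show ?thesis
      using G(2,3) P(2) by (simp add: sum.union_disjoint)
  qed
  finally have "c * norm (a n) = norm (fps_nth G (m + 2)
       + (\<Sum>i=1..m. fps_nth P i * fps_nth G (m + 2 - i)) + fps_nth P (m + 1))"
    using c_nonneg by (metis norm_mult norm_of_real abs_of_nonneg)
  also have "\<dots> \<le> pochhammer B (m + 1) / fact (m + 1)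
       + (\<Sum>k=1..m. C * (pochhammer B (m + 1 - k) / fact (m + 1 - k))) + C"
  proof (intro norm_triangle_le add_mono sum_norm_le)
    show "norm (fps_nth G (m + 2)) \<le> pochhammer B (m + 1) / fact (m + 1)"
      using G(4) [of "m + 1"] by (simp add: B_def)
    show "norm (fps_nth P (m + 1)) \<le> C"
      using P(3) by (simp add: C_def)
    fix k assume k: "k \<in> {1..m}"
    have "norm (fps_nth G (m + 2 - k)) \<le> pochhammer B (m + 1 - k) / fact (m + 1 - k)"
      using G(4) [of "m + 1 - k"] k by (simp add: B_def Suc_diff_le)
    then show "norm (fps_nth P k * fps_nth G (m + 2 - k))
                 \<le> C * (pochhammer B (m + 1 - k) / fact (m + 1 - k))"
      using P(3) k unfolding norm_mult C_def by (intro mult_mono) auto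
  qed
  also have "\<dots> = (\<Prod>j=0..n-2. real j + B) / fact (n - 1)
           + C * (1 + (\<Sum>k=1..n-2. (\<Prod>j=0..n-k-2. real j + B) / fact (n - k - 1)))"
  proof -
    \<comment> \<open>A product over \<open>0..r\<close> has \<open>Suc r\<close> factors. For
      \<open>k \<le> m\<close> the subtraction \<open>n - k - 2\<close> does not truncate: it is
      \<open>m - k\<close>, which matches the Pochhammer index \<open>m + 1 - k\<close>.\<close>
    have prod: "(\<Prod>j=0..r. real j + B) = pochhammer B (Suc r)" for r
      by (simp add: pochhammer_Suc_prod add.commute)
    have "(\<Sum>k=1..m. (\<Prod>j=0..n-k-2. real j + B) / fact (n - k - 1)) =
            (\<Sum>k=1..m. pochhammer B (m + 1 - k) / fact (m + 1 - k))"
      unfolding prod n by (intro sum.cong refl) (auto simp: Suc_diff_le)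
    then show ?thesis
      unfolding prod sum_distrib_left [symmetric] by (simp add: n distrib_left)
  qed
  finally show ?thesis
    unfolding c_def B_def C_def .
qed

end
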